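(* For each integer $n\ge 1$ let $X_n$ be the number of blocks in a uniformly random non-crossing partition of $[n]=\{1,\dots,n\}$. Then $$\mathbb{E}(X_n)=\frac{n+1}{2},\qquad \mathrm{Var}(X_n)=\frac{n^2-1}{4(2n-1)}\sim\frac{n}{8}\quad(n\to\infty).$$ Moreover, let $$Z_n=\frac{X_n-\mathbb{E}(X_n)}{\sqrt{\mathrm{Var}(X_n)}}.$$ Then, as $n\to\infty$, the cumulative distribution function of $Z_n$ converges to the standard Gaussian distribution function $\Phi(x)$.
   Context: A partition of $[n]=\{1,\dots,n\}$ into (nonempty) subsets, called blocks, is non-crossing if there are no elements $a<b<c<d$ such that $a$ and $c$ lie in one block and $b$ and $d$ lie in a different block. A random non-crossing partition of $[n]$ is one chosen uniformly from the finite set of all non-crossing partitions of $[n]$. *)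

theory Defs
  imports "HOL-Probability.Probability" "HOL-Library.Disjoint_Sets"
    "HOL-Library.Landau_Symbols"
begin

definition non_crossing :: "nat set set \<Rightarrow> bool" where
  "non_crossing P \<longleftrightarrow>
     \<not> (\<exists>B\<in>P. \<exists>B'\<in>P. B \<noteq> B' \<and>
          (\<exists>a b c d. a < b \<and> b < c \<and> c < d \<and> a \<in> B \<and> c \<in> B \<and> b \<in> B' \<and> d \<in> B'))"

definition nc_partitions :: "nat \<Rightarrow> nat set set set" where
  "nc_partitions n = {P. partition_on {1..n} P \<and> non_crossing P}"

lemma finite_nc_partitions: "finite (nc_partitions n)"
  by (rule finite_subset[OF _ finitely_many_partition_on[of "{1..n}"]])
     (auto simp: nc_partitions_def)

lemma nc_partitions_nonempty: "nc_partitions n \<noteq> {}"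
proof -
  have "(\<lambda>i. {i}) ` {1..n} \<in> nc_partitions n"
    by (auto simp: nc_partitions_def non_crossing_def partition_on_def disjoint_def)
  then show ?thesis by blast
qed

text \<open>
  The law of a uniformly random non-crossing partition. The two facts above are what makes
  \<open>pmf_of_set\<close> the uniform distribution.
\<close>
definition random_nc_partition :: "nat \<Rightarrow> nat set set pmf" where
  "random_nc_partition n = pmf_of_set (nc_partitions n)"

definition num_blocks :: "nat set set \<Rightarrow> real" where
  "num_blocks P = real (card P)"

definition mean_blocks :: "nat \<Rightarrow> real" where
  "mean_blocks n = measure_pmf.expectation (random_nc_partition n) num_blocks"

definition var_blocks :: "nat \<Rightarrow> real" where
  "var_blocks n = measure_pmf.variance (random_nc_partition n) num_blocks"

text \<open>
  For \<open>n = 1\<close> the variance is 0 and division by zero makes this 0; only the limit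
  as \<open>n\<close> tends to infinity is of interest.
\<close>
definition standardized_blocks :: "nat \<Rightarrow> nat set set \<Rightarrow> real" where
  "standardized_blocks n P = (num_blocks P - mean_blocks n) / sqrt (var_blocks n)"

end

theory Submission
  imports Defs "HOL-Real_Asymp.Real_Asymp"
begin

text \<open>
  The number of blocks of a random non-crossing partition is hypergeometric: it is distributed as
  the number of marked balls in a sample of \<open>n + 1\<close> balls drawn without replacement from an urn
  with \<open>n\<close> marked and \<open>n\<close> unmarked ones. Mean, variance and the Gaussian limit all come from this.

  The count behind it is that of Narayana: \<open>n\<close> times the number of non-crossing partitions
  of \<open>[n]\<close> with \<open>k\<close> blocks is \<open>(n choose k) * (n choose (k - 1))\<close> (\<open>narayana_count\<close>). It is obtained from
  a generating tree. Deleting \<open>n + 1\<close> from a non-crossing partition of \<open>[n + 1]\<close> leaves a non-crossing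
  partition of \<open>[n]\<close>; conversely \<open>n + 1\<close> may be put back as a singleton or be added to a block that
  has no element under an arc of another block. Call such a block exposed. The exposed blocks are linearly
  ordered from left to right, and adding \<open>n + 1\<close> to the \<open>r\<close>-th of them covers all later ones and leaves
  exactly \<open>r\<close> exposed. So the number of exposed blocks together with the number of all blocks evolves
  autonomously (\<open>sum_nc_partitions_Suc\<close>), which gives a linear recurrence for the joint counts; their
  closed form (\<open>nc_count_closed_form\<close>) is verified by induction and summed over the number of
  exposed blocks.

  For the limit law, expand \<open>(2 cos (u/2 + s/4))^n (2 cos (u/2 - s/4))^n = (2 cos u + 2 cos (s/2))^n\<close>
  by the binomial theorem. A single Fourier coefficient in \<open>u\<close> of this function is the exponential
  sum \<open>\<Sum>k. (n choose k) (n choose (n + 1 - k)) exp (i s (k - (n + 1)/2))\<close>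
  (\<open>binomial_convolution_Fourier\<close>), so the characteristic function of the standardized block
  number at \<open>t\<close> is a quotient of two integrals of \<open>((cos u + cos (s/2)) / 2)^n exp (-i u)\<close> over
  \<open>[-pi, pi]\<close>, with \<open>s = t / \<sigma>\<close> and with \<open>s = 0\<close>. Substituting \<open>u = v / sqrt n\<close>, the integrand
  tends to \<open>exp (-v^2/4 - t^2/2)\<close> because \<open>\<sigma>^2\<close> is asymptotically \<open>n / 8\<close>, and it is dominated by a
  Gaussian (\<open>half_cos_sum_bound\<close>). Hence the quotient tends to \<open>exp (-t^2/2)\<close>, and Levy's
  continuity theorem applies.
\<close>

section \<open>The block structure of non-crossing partitions\<close>

text \<open>
  Some element of \<open>B\<close> lies under an arc of \<open>B'\<close>. An element larger than all others cannot be added to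
  such a \<open>B\<close> without creating a crossing with \<open>B'\<close>.
\<close>
definition enclosed :: "nat set \<Rightarrow> nat set \<Rightarrow> bool" where
  "enclosed B B' \<longleftrightarrow> (\<exists>a\<in>B'. \<exists>b\<in>B. \<exists>c\<in>B'. a < b \<and> b < c)"

definition exposed :: "nat set set \<Rightarrow> nat set set" where
  "exposed P = {B \<in> P. \<forall>B'\<in>P. B' \<noteq> B \<longrightarrow> \<not> enclosed B B'}"

definition extend_block :: "nat \<Rightarrow> nat set \<Rightarrow> nat set set \<Rightarrow> nat set set" where
  "extend_block m B P = insert (insert m B) (P - {B})"

lemma non_crossingD:
  assumes "non_crossing P" "B \<in> P" "B' \<in> P" "a < b" "b < c" "c < d" "a \<in> B" "c \<in> B" "b \<in> B'" "d \<in> B'"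
  shows "B = B'"
  using assms unfolding non_crossing_def by blast

lemma nc_partitions_blocks:
  assumes "P \<in> nc_partitions n" "B \<in> P"
  shows "B \<subseteq> {1..n}" "B \<noteq> {}" "finite B" "Suc n \<notin> B"
proof -
  show sub: "B \<subseteq> {1..n}" and "B \<noteq> {}"
    using assms unfolding nc_partitions_def partition_on_def by blast+
  show "finite B" "Suc n \<notin> B" using sub finite_subset by auto
qed

lemma nc_partitions_disjoint:
  assumes "P \<in> nc_partitions n" "B \<in> P" "B' \<in> P" "B \<noteq> B'"
  shows "B \<inter> B' = {}"
  using assms unfolding nc_partitions_def partition_on_def disjoint_def by blast

lemma nc_partitions_no_empty:
  assumes "P \<in> nc_partitions n"
  shows "{} \<notin> P"
  using assms by (simp add: nc_partitions_def partition_on_def)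

lemma nc_partitions_finite:
  assumes "P \<in> nc_partitions n"
  shows "finite P"
  using assms finite_elements[of "{1..n}" P] by (simp add: nc_partitions_def)

lemma nc_partitions_Union:
  assumes "P \<in> nc_partitions n"
  shows "\<Union>P = {1..n}"
  using assms by (simp add: nc_partitions_def partition_on_def)

lemma nc_partitions_0: "nc_partitions 0 = {{}}"
  by (auto simp: nc_partitions_def non_crossing_def partition_on_empty)

lemma insert_singleton_nc_partitions:
  assumes "P \<in> nc_partitions n"
  shows "insert {Suc n} P \<in> nc_partitions (Suc n)"
proof -
  have "partition_on {1..Suc n} (insert {Suc n} P)"
    using assms nc_partitions_blocks[OF assms]
    by (auto simp: nc_partitions_def atLeastAtMostSuc_conv partition_on_def disjoint_def)
  moreover have "non_crossing (insert {Suc n} P)"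
    unfolding non_crossing_def
  proof (intro notI, elim bexE exE conjE)
    fix B B' a b c d
    assume *: "B \<in> insert {Suc n} P" "B' \<in> insert {Suc n} P" "B \<noteq> B'"
      "a < b" "b < c" "c < d" "a \<in> B" "c \<in> B" "b \<in> B'" "d \<in> B'"
    then have "B \<in> P" "B' \<in> P" by auto
    then show False
      using non_crossingD[of P B B' a b c d] * assms by (auto simp: nc_partitions_def)
  qed
  ultimately show ?thesis by (simp add: nc_partitions_def)
qed

text \<open>
  A crossing that does not use \<open>n + 1\<close> is already a crossing in \<open>P\<close>. In one that does, \<open>n + 1\<close> is the
  largest of the four points, so the other three exhibit an element of \<open>B\<close> under an arc of another
  block, which exposedness excludes.
\<close>
lemma extend_block_nc_partitions:
  assumes P: "P \<in> nc_partitions n" and B: "B \<in> exposed P"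
  shows "extend_block (Suc n) B P \<in> nc_partitions (Suc n)"
proof -
  have BP: "B \<in> P" using B by (simp add: exposed_def)
  note blk = nc_partitions_blocks[OF P]
  have "\<Union>(extend_block (Suc n) B P) = insert (Suc n) (\<Union>P)"
    using BP by (auto simp: extend_block_def)
  then have Union: "\<Union>(extend_block (Suc n) B P) = {1..Suc n}"
    using nc_partitions_Union[OF P] by (simp add: atLeastAtMostSuc_conv)
  have "disjoint (extend_block (Suc n) B P)"
  proof (rule disjointI)
    fix X Y assume XY: "X \<in> extend_block (Suc n) B P" "Y \<in> extend_block (Suc n) B P" "X \<noteq> Y"
    have old: "Z \<inter> insert (Suc n) B = {}" if "Z \<in> P - {B}" for Z
      using that nc_partitions_disjoint[OF P _ BP, of Z] blk(4)[of Z] by auto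
    consider "X \<in> P" "Y \<in> P" | "X = insert (Suc n) B" "Y \<in> P - {B}"
      | "X \<in> P - {B}" "Y = insert (Suc n) B"
      using XY by (auto simp: extend_block_def)
    then show "X \<inter> Y = {}"
      using nc_partitions_disjoint[OF P _ _ XY(3)] old[of X] old[of Y] by cases auto
  qed
  moreover have "{} \<notin> extend_block (Suc n) B P"
    using blk by (auto simp: extend_block_def)
  moreover have "non_crossing (extend_block (Suc n) B P)"
    unfolding non_crossing_def
  proof (intro notI, elim bexE exE conjE)
    fix C C' a b c d
    assume CC: "C \<in> extend_block (Suc n) B P" "C' \<in> extend_block (Suc n) B P" "C \<noteq> C'"
      and lt: "a < b" "b < c" "c < d" and mem: "a \<in> C" "c \<in> C" "b \<in> C'" "d \<in> C'"
    have old: "X - {Suc n} \<in> P" if "X \<in> extend_block (Suc n) B P" for X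
      using that BP blk by (auto simp: extend_block_def)
    have d: "d \<le> Suc n"
      using mem(4) CC(2) Union by auto
    show False
    proof (cases "d = Suc n")
      case False
      then have "C - {Suc n} = C' - {Suc n}"
        using non_crossingD[OF _ old[OF CC(1)] old[OF CC(2)] lt] P mem lt d
        by (simp add: nc_partitions_def)
      moreover have "a \<in> C - {Suc n}" using mem lt d by simp
      ultimately show False
        using CC BP blk(4) by (auto simp: extend_block_def)
    next
      case True
      then have C': "C' = insert (Suc n) B"
        using mem(4) CC(2) blk by (auto simp: extend_block_def)
      then have C: "C \<in> P" "C \<noteq> B" using CC by (auto simp: extend_block_def)
      have "b \<in> B" using C' mem lt True by auto
      then have "enclosed B C" unfolding enclosed_def using mem lt by blast
      then show False using B C by (auto simp: exposed_def)
    qed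
  qed
  ultimately show ?thesis using Union by (simp add: nc_partitions_def partition_on_def)
qed

text \<open>
  The block \<open>C\<close> of \<open>n + 1\<close> decides: if it is a singleton it is dropped, otherwise only \<open>n + 1\<close> is
  removed from it. The rest of \<open>C\<close> is then exposed, since an arc over one of its elements would cross
  the arc from that element to \<open>n + 1\<close>.
\<close>
lemma nc_partitions_Suc_cases:
  assumes P: "P \<in> nc_partitions (Suc n)"
  obtains (singleton) Q where "Q \<in> nc_partitions n" "P = insert {Suc n} Q"
  | (extend) Q B where "Q \<in> nc_partitions n" "B \<in> exposed Q" "P = extend_block (Suc n) B Q"
proof -
  note blk = nc_partitions_blocks[OF P]
  have "Suc n \<in> \<Union>P" using nc_partitions_Union[OF P] by simp
  then obtain C where C: "C \<in> P" "Suc n \<in> C" by blast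
  have other: "Suc n \<notin> X" if "X \<in> P - {C}" for X
    using nc_partitions_disjoint[OF P, of X C] C that by blast
  have nc: "non_crossing P" using P by (simp add: nc_partitions_def)
  have disj: "disjoint (P - {C})"
    using nc_partitions_disjoint[OF P] unfolding disjoint_def by blast
  show thesis
  proof (cases "C = {Suc n}")
    case True
    have "\<Union>(P - {C}) = \<Union>P - {Suc n}" using True C other by blast
    then have "\<Union>(P - {C}) = {1..n}"
      using nc_partitions_Union[OF P] by auto
    moreover have "non_crossing (P - {C})"
      using nc unfolding non_crossing_def by (meson DiffD1)
    ultimately have "P - {C} \<in> nc_partitions n"
      using disj nc_partitions_no_empty[OF P] by (simp add: nc_partitions_def partition_on_def)
    moreover have "P = insert {Suc n} (P - {C})" using C True by auto
    ultimately show thesis by (rule singleton)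
  next
    case False
    define B where "B = C - {Suc n}"
    define Q where "Q = insert B (P - {C})"
    have Bne: "B \<noteq> {}" using False C by (auto simp: B_def)
    have BnP: "B \<notin> P"
      using Bne C nc_partitions_disjoint[OF P, of B C] unfolding B_def by blast
    have "\<Union>Q = \<Union>P - {Suc n}" using C other unfolding Q_def B_def by blast
    then have "\<Union>Q = {1..n}"
      using nc_partitions_Union[OF P] by auto
    moreover have "disjoint Q"
    proof -
      have "X \<inter> B = {}" if "X \<in> P - {C}" for X
        using that nc_partitions_disjoint[OF P, of X C] C by (auto simp: B_def)
      with disj show ?thesis
        unfolding Q_def by (metis disjointD disjointI Int_commute insertE)
    qed
    moreover have "non_crossing Q"
      unfolding non_crossing_def
    proof (intro notI, elim bexE exE conjE)
      fix X X' a b c d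
      assume XX: "X \<in> Q" "X' \<in> Q" "X \<noteq> X'"
        and lt: "a < b" "b < c" "c < d" and mem: "a \<in> X" "c \<in> X" "b \<in> X'" "d \<in> X'"
      \<comment> \<open>A crossing in \<open>Q\<close> persists when \<open>n + 1\<close> is put back into \<open>B\<close>.\<close>
      define up where "up Y = (if Y = B then C else Y)" for Y
      have up: "up Y \<in> P" "Y \<subseteq> up Y" if "Y \<in> Q" for Y
        using that C unfolding Q_def up_def B_def by auto
      have "a \<in> up X" "c \<in> up X" "b \<in> up X'" "d \<in> up X'"
        using up(2)[OF XX(1)] up(2)[OF XX(2)] mem by auto
      then have "up X = up X'"
        by (rule non_crossingD[OF nc up(1)[OF XX(1)] up(1)[OF XX(2)] lt])
      moreover have "Y = B \<or> Y \<noteq> C" if "Y \<in> Q" for Y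
        using that by (auto simp: Q_def)
      ultimately show False
        using XX unfolding up_def by metis
    qed
    ultimately have "Q \<in> nc_partitions n"
      using nc_partitions_no_empty[OF P] Bne by (simp add: nc_partitions_def partition_on_def Q_def)
    moreover have "B \<in> exposed Q"
    proof -
      have "\<not> enclosed B X" if "X \<in> Q" "X \<noteq> B" for X
      proof
        assume "enclosed B X"
        then obtain a b c where abc: "a \<in> X" "b \<in> B" "c \<in> X" "a < b" "b < c"
          by (auto simp: enclosed_def)
        have X: "X \<in> P" "X \<noteq> C" using that by (auto simp: Q_def)
        then have "c < Suc n" using abc blk(1)[of X] other[of X] C
          by (metis Diff_iff atLeastAtMost_iff le_neq_implies_less singletonD subsetD)
        then have "X = C"
          using non_crossingD[OF nc X(1) C(1) abc(4,5)] abc C by (auto simp: B_def)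
        then show False using X by simp
      qed
      then show ?thesis by (auto simp: exposed_def Q_def)
    qed
    moreover have "P = extend_block (Suc n) B Q"
      using C BnP by (auto simp: extend_block_def Q_def B_def insert_absorb)
    ultimately show thesis by (rule extend)
  qed
qed

section \<open>The generating tree\<close>

lemma exposed_insert_singleton:
  assumes P: "P \<in> nc_partitions n"
  shows "exposed (insert {Suc n} P) = insert {Suc n} (exposed P)"
proof -
  have "\<not> enclosed {Suc n} X" if "X \<in> P" for X
    using nc_partitions_blocks(1)[OF P that] by (auto simp: enclosed_def)
  moreover have "\<not> enclosed X {Suc n}" for X
    by (auto simp: enclosed_def)
  ultimately show ?thesis
    unfolding exposed_def by blast
qed

text \<open>
  An exposed block \<open>X\<close> has no element under the arcs of \<open>B\<close>; so once it has an element to the right of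
  some element of \<open>B\<close>, that element is to the right of all of \<open>B\<close>. In this way the maxima order the
  exposed blocks from left to right.
\<close>
lemma exposed_Max_less_iff:
  assumes P: "P \<in> nc_partitions n" and X: "X \<in> exposed P" and B: "B \<in> P" "X \<noteq> B"
  shows "(\<exists>a\<in>B. \<exists>b\<in>X. a < b) \<longleftrightarrow> Max B < Max X"
proof
  have XP: "X \<in> P" and ne: "\<not> enclosed X B"
    using X B by (auto simp: exposed_def)
  note fin = nc_partitions_blocks(2,3)[OF P]
  have Max_in: "Max B \<in> B" "Max X \<in> X" using fin[OF B(1)] fin[OF XP] by auto
  assume "\<exists>a\<in>B. \<exists>b\<in>X. a < b"
  then obtain a b where ab: "a \<in> B" "b \<in> X" "a < b" by blast
  have "b \<notin> B" using nc_partitions_disjoint[OF P XP B] ab by blast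
  then have "b \<noteq> Max B" using Max_in by auto
  moreover have "\<not> b < Max B" using ne ab Max_in unfolding enclosed_def by blast
  ultimately have "Max B < b" by simp
  then show "Max B < Max X" using fin[OF XP] ab(2) by (meson Max_ge less_le_trans)
next
  have XP: "X \<in> P" using X by (auto simp: exposed_def)
  note fin = nc_partitions_blocks(2,3)[OF P]
  assume "Max B < Max X"
  then show "\<exists>a\<in>B. \<exists>b\<in>X. a < b" using fin[OF XP] fin[OF B(1)] Max_in by blast
qed

text \<open>
  The new arc from \<open>B\<close> to \<open>n + 1\<close> covers precisely the exposed blocks to the right of \<open>B\<close>. Those to
  the left remain exposed, and \<open>B\<close> itself does because it gains only the largest element.
\<close>
lemma exposed_extend_block:
  assumes P: "P \<in> nc_partitions n" and B: "B \<in> exposed P"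
  shows "exposed (extend_block (Suc n) B P) =
    insert (insert (Suc n) B) {X \<in> exposed P. Max X < Max B}"
proof -
  have BP: "B \<in> P" using B by (simp add: exposed_def)
  note blk = nc_partitions_blocks[OF P]
  define C where "C = insert (Suc n) B"
  have CP: "C \<notin> P" using blk(4) by (auto simp: C_def)
  have C_free: "\<not> enclosed C X" if "X \<in> P - {B}" for X
  proof
    assume "enclosed C X"
    then obtain a b c where abc: "a \<in> X" "b \<in> C" "c \<in> X" "a < b" "b < c"
      by (auto simp: enclosed_def)
    have "c \<le> n" using blk(1)[of X] abc that by auto
    then have "b \<in> B" using abc by (auto simp: C_def)
    then have "enclosed B X" using abc unfolding enclosed_def by blast
    then show False using B that by (auto simp: exposed_def)
  qed
  have encl_C: "enclosed X C \<longleftrightarrow> (\<exists>a\<in>B. \<exists>b\<in>X. a < b)" if "X \<in> P" for X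
    using blk(1)[OF that] unfolding enclosed_def C_def
    by (auto simp: subset_iff) (metis le_imp_less_Suc)+
  have other: "X \<in> exposed (insert C (P - {B})) \<longleftrightarrow> X \<in> exposed P \<and> Max X < Max B"
    if X: "X \<in> P - {B}" for X
  proof -
    have "X \<in> exposed (insert C (P - {B})) \<longleftrightarrow> X \<in> exposed P \<and> \<not> (\<exists>a\<in>B. \<exists>b\<in>X. a < b)"
    proof -
      have "\<not> enclosed X B" if "\<not> (\<exists>a\<in>B. \<exists>b\<in>X. a < b)"
        using that by (auto simp: enclosed_def)
      then show ?thesis
        using X CP encl_C[of X] BP unfolding exposed_def by auto
    qed
    moreover have "Max X \<noteq> Max B"
      using X BP nc_partitions_disjoint[OF P, of X B] blk(2,3)[of X] blk(2,3)[of B] Max_in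
      by (metis DiffD1 DiffD2 disjoint_iff insertCI)
    ultimately show ?thesis
      using exposed_Max_less_iff[OF P _ BP, of X] X by (auto simp: linorder_neq_iff)
  qed
  have "C \<in> exposed (insert C (P - {B}))"
    using C_free by (auto simp: exposed_def)
  moreover have "X = C \<or> X \<in> P - {B}" if "X \<in> exposed (insert C (P - {B}))" for X
    using that by (auto simp: exposed_def)
  moreover have "X \<in> P - {B}" if "X \<in> exposed P" "Max X < Max B" for X
    using that by (auto simp: exposed_def)
  ultimately have "exposed (insert C (P - {B})) = insert C {X \<in> exposed P. Max X < Max B}"
    using other by blast
  then show ?thesis by (simp add: extend_block_def C_def)
qed

lemma sum_over_ranks_linorder:
  fixes A :: "'a::linorder set"
  assumes "finite A"
  shows "(\<Sum>a\<in>A. h (card {y\<in>A. y \<le> a})) = (\<Sum>r=1..card A. h r :: 'b::comm_monoid_add)"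
  using assms
proof (induction A rule: finite_linorder_max_induct)
  case empty
  then show ?case by simp
next
  case (insert m A)
  have m: "m \<notin> A" using insert by auto
  have "{y \<in> insert m A. y \<le> m} = insert m A" using insert by auto
  moreover have "{y \<in> insert m A. y \<le> a} = {y \<in> A. y \<le> a}" if "a \<in> A" for a
    using insert that by force
  ultimately show ?case using insert m by (simp add: add.commute)
qed

text \<open>
  An injective key ranks the elements of a finite set as \<open>1, \<dots>, card E\<close>. It is applied to the
  exposed blocks with \<open>Max\<close> as key.
\<close>
lemma sum_over_ranks:
  fixes f :: "'a \<Rightarrow> 'c::linorder"
  assumes "finite E" "inj_on f E"
  shows "(\<Sum>x\<in>E. h (card {y\<in>E. f y \<le> f x})) = (\<Sum>r=1..card E. h r :: 'b::comm_monoid_add)"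
proof -
  have "card {z \<in> f ` E. z \<le> f x} = card {y\<in>E. f y \<le> f x}" if "x \<in> E" for x
  proof -
    have "{z \<in> f ` E. z \<le> f x} = f ` {y\<in>E. f y \<le> f x}" by auto
    then show ?thesis using assms(2) by (simp add: card_image inj_on_subset)
  qed
  then show ?thesis
    using sum_over_ranks_linorder[of "f ` E" h] assms
    by (simp add: sum.reindex card_image)
qed

lemma finite_exposed:
  assumes "P \<in> nc_partitions n"
  shows "finite (exposed P)"
  using nc_partitions_finite[OF assms] by (simp add: exposed_def)

lemma inj_on_Max_nc_partition:
  assumes P: "P \<in> nc_partitions n"
  shows "inj_on Max P"
proof (rule inj_onI, rule ccontr)
  fix X Y assume XY: "X \<in> P" "Y \<in> P" "Max X = Max Y" "X \<noteq> Y"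
  then have "Max X \<in> X" "Max X \<in> Y"
    using nc_partitions_blocks(2,3)[OF P] Max_in by metis+
  then show False using nc_partitions_disjoint[OF P XY(1,2,4)] by blast
qed

lemma card_insert_singleton:
  assumes "P \<in> nc_partitions n"
  shows "card (insert {Suc n} P) = Suc (card P)"
    and "card (exposed (insert {Suc n} P)) = Suc (card (exposed P))"
proof -
  have "{Suc n} \<notin> P" using nc_partitions_blocks(4)[OF assms] by blast
  then show "card (insert {Suc n} P) = Suc (card P)"
    using nc_partitions_finite[OF assms] by simp
  have "{Suc n} \<notin> exposed P" using \<open>{Suc n} \<notin> P\<close> by (simp add: exposed_def)
  then show "card (exposed (insert {Suc n} P)) = Suc (card (exposed P))"
    using finite_exposed[OF assms] by (simp add: exposed_insert_singleton[OF assms])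
qed

lemma card_extend_block:
  assumes P: "P \<in> nc_partitions n" and B: "B \<in> exposed P"
  shows "card (extend_block (Suc n) B P) = card P"
    and "card (exposed (extend_block (Suc n) B P)) = card {X \<in> exposed P. Max X \<le> Max B}"
proof -
  have BP: "B \<in> P" using B by (simp add: exposed_def)
  have new: "insert (Suc n) B \<notin> P" using nc_partitions_blocks(4)[OF P] by blast
  show "card (extend_block (Suc n) B P) = card P"
    using new BP nc_partitions_finite[OF P] card_gt_0_iff[of P]
    by (auto simp: extend_block_def)
  have "insert (Suc n) B \<notin> exposed P" using new by (simp add: exposed_def)
  moreover have "{X \<in> exposed P. Max X \<le> Max B} = insert B {X \<in> exposed P. Max X < Max B}"
    using inj_on_Max_nc_partition[OF P] B unfolding exposed_def inj_on_def
    by (auto simp: le_less)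
  ultimately show "card (exposed (extend_block (Suc n) B P)) = card {X \<in> exposed P. Max X \<le> Max B}"
    using finite_exposed[OF P] by (simp add: exposed_extend_block[OF P B])
qed

text \<open>
  Deleting \<open>n + 1\<close> recovers the parent, so an extension arises from only one partition of \<open>[n]\<close>.
\<close>
lemma extend_block_remove:
  assumes P: "P \<in> nc_partitions n" and B: "B \<in> P"
  shows "(\<lambda>X. X - {Suc n}) ` extend_block (Suc n) B P = P"
proof -
  have "X - {Suc n} = X" if "X \<in> P" for X
    using nc_partitions_blocks(4)[OF P that] by simp
  then have "(\<lambda>X. X - {Suc n}) ` (P - {B}) = P - {B}" by auto
  moreover have "insert (Suc n) B - {Suc n} = B" using nc_partitions_blocks(4)[OF P B] by simp
  ultimately show ?thesis using B by (auto simp: extend_block_def)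
qed

text \<open>
  The transition rule of the generating tree: a parent with \<open>v\<close> exposed blocks among \<open>k\<close> blocks has one
  child with statistics \<open>(v + 1, k + 1)\<close> (the new singleton is exposed) and, for each \<open>r\<close> from \<open>1\<close> to
  \<open>v\<close>, one child with statistics \<open>(r, k)\<close>. Stating it for an arbitrary weight \<open>h\<close> allows to read
  off a recurrence for any joint count by inserting an indicator function.
\<close>
lemma sum_nc_partitions_Suc:
  fixes h :: "nat \<Rightarrow> nat \<Rightarrow> 'b::comm_monoid_add"
  shows "(\<Sum>P\<in>nc_partitions (Suc n). h (card (exposed P)) (card P)) =
    (\<Sum>P\<in>nc_partitions n. h (Suc (card (exposed P))) (Suc (card P))
       + (\<Sum>r=1..card (exposed P). h r (card P)))"
proof -
  let ?N = "nc_partitions n" and ?H = "\<lambda>P. h (card (exposed P)) (card P)"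
  define S where "S = insert {Suc n} ` ?N"
  define T where "T = (\<lambda>(P, B). extend_block (Suc n) B P) ` Sigma ?N exposed"
  have exP: "B \<in> P" if "B \<in> exposed P" for B P
    using that by (simp add: exposed_def)
  have "nc_partitions (Suc n) = S \<union> T"
  proof
    show "nc_partitions (Suc n) \<subseteq> S \<union> T"
    proof
      fix P assume "P \<in> nc_partitions (Suc n)"
      then show "P \<in> S \<union> T"
        by (cases rule: nc_partitions_Suc_cases) (auto simp: S_def T_def)
    qed
    show "S \<union> T \<subseteq> nc_partitions (Suc n)"
      by (auto simp: S_def T_def insert_singleton_nc_partitions extend_block_nc_partitions)
  qed
  moreover have "S \<inter> T = {}"
  proof -
    have "{Suc n} \<notin> extend_block (Suc n) B P" if "P \<in> ?N" "B \<in> exposed P" for P B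
      using nc_partitions_blocks(2,4)[OF that(1)] exP[OF that(2)]
      by (auto simp: extend_block_def)
    then show ?thesis by (auto simp: S_def T_def)
  qed
  moreover have "finite S" "finite T"
    using finite_nc_partitions finite_exposed by (auto simp: S_def T_def )
  ultimately have "sum ?H (nc_partitions (Suc n)) = sum ?H S + sum ?H T"
    by (simp add: sum.union_disjoint)
  also have "sum ?H S = (\<Sum>P\<in>?N. h (Suc (card (exposed P))) (Suc (card P)))"
  proof -
    have "inj_on (insert {Suc n}) ?N"
    proof (rule inj_onI)
      fix P Q assume "P \<in> ?N" "Q \<in> ?N" "insert {Suc n} P = insert {Suc n} Q"
      then show "P = Q"
        using nc_partitions_blocks(4) by (metis insert_ident singletonI)
    qed
    then show ?thesis
      by (simp add: S_def sum.reindex card_insert_singleton)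
  qed
  also have "sum ?H T = (\<Sum>(P, B)\<in>Sigma ?N exposed. h (card {X \<in> exposed P. Max X \<le> Max B}) (card P))"
  proof -
    have "inj_on (\<lambda>(P, B). extend_block (Suc n) B P) (Sigma ?N exposed)"
    proof (rule inj_onI, clarify)
      fix P B Q C
      assume *: "P \<in> ?N" "B \<in> exposed P" "Q \<in> ?N" "C \<in> exposed Q"
        and eq: "extend_block (Suc n) B P = extend_block (Suc n) C Q"
      have PQ: "P = Q"
        using extend_block_remove[OF *(1) exP[OF *(2)]] extend_block_remove[OF *(3) exP[OF *(4)]] eq
        by simp
      have "insert (Suc n) B \<in> extend_block (Suc n) C Q"
        using eq by (auto simp: extend_block_def)
      then have "insert (Suc n) B = insert (Suc n) C"
        using nc_partitions_blocks(4)[OF *(3)] by (auto simp: extend_block_def)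
      then have "B = C"
        using nc_partitions_blocks(4)[OF *(1) exP[OF *(2)]] nc_partitions_blocks(4)[OF *(3) exP[OF *(4)]]
        by (metis insert_ident)
      with PQ show "P = Q \<and> B = C" by simp
    qed
    then show ?thesis
      by (auto simp: T_def sum.reindex card_extend_block intro!: sum.cong)
  qed
  also have "\<dots> = (\<Sum>P\<in>?N. \<Sum>B\<in>exposed P. h (card {X \<in> exposed P. Max X \<le> Max B}) (card P))"
    using finite_nc_partitions finite_exposed by (subst sum.Sigma) auto
  also have "\<dots> = (\<Sum>P\<in>?N. \<Sum>r=1..card (exposed P). h r (card P))"
  proof (rule sum.cong[OF refl])
    fix P assume P: "P \<in> ?N"
    have "inj_on Max (exposed P)"
      using inj_on_Max_nc_partition[OF P] exP by (meson inj_on_subset subsetI)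
    then show "(\<Sum>B\<in>exposed P. h (card {X \<in> exposed P. Max X \<le> Max B}) (card P)) =
        (\<Sum>r=1..card (exposed P). h r (card P))"
      using sum_over_ranks[OF finite_exposed[OF P], of Max "\<lambda>r. h r (card P)"] by simp
  qed
  finally show ?thesis by (simp add: sum.distrib)
qed

section \<open>Narayana numbers\<close>

text \<open>
  Indexing by the number \<open>j\<close> of blocks that are not exposed, instead of the number of all blocks, avoids
  a truncated subtraction in the closed form.
\<close>
definition nc_count :: "nat \<Rightarrow> nat \<Rightarrow> nat \<Rightarrow> nat" where
  "nc_count n v j = card {P \<in> nc_partitions n. card (exposed P) = v \<and> card P = v + j}"

lemma card_exposed_le:
  assumes "P \<in> nc_partitions n"
  shows "card (exposed P) \<le> card P"
  using nc_partitions_finite[OF assms] by (auto simp: exposed_def intro: card_mono)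

lemma card_filter_eq_sum:
  assumes "finite A"
  shows "card {x \<in> A. Q x} = (\<Sum>x\<in>A. of_bool (Q x))"
  using assms by (simp add: of_bool_def sum.If_cases Collect_conj_eq)

lemma nc_count_Suc_0: "nc_count (Suc n) 0 j = 0"
proof -
  have "nc_count (Suc n) 0 j =
      (\<Sum>P\<in>nc_partitions (Suc n). of_bool (card (exposed P) = 0 \<and> card P = 0 + j))"
    by (simp only: nc_count_def card_filter_eq_sum finite_nc_partitions)
  also have "\<dots> = 0"
    by (subst sum_nc_partitions_Suc[of "\<lambda>v k. of_bool (v = 0 \<and> k = 0 + j)"]) auto
  finally show ?thesis .
qed

text \<open>
  The first summand counts the children in which \<open>n + 1\<close> is a singleton. The other children keep
  the number of blocks, and such a parent has exactly one child with \<open>Suc v\<close> exposed blocks as soon as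
  it has at least \<open>Suc v\<close> of them; \<open>i\<close> is the number of exposed blocks that get covered.
\<close>
lemma nc_count_Suc_Suc:
  "nc_count (Suc n) (Suc v) j = nc_count n v j + (\<Sum>i\<le>j. nc_count n (Suc v + i) (j - i))"
proof -
  let ?N = "nc_partitions n"
  have "nc_count (Suc n) (Suc v) j =
      (\<Sum>P\<in>nc_partitions (Suc n). of_bool (card (exposed P) = Suc v \<and> card P = Suc v + j))"
    by (simp only: nc_count_def card_filter_eq_sum finite_nc_partitions)
  also have "\<dots> = (\<Sum>P\<in>?N. of_bool (card (exposed P) = v \<and> card P = v + j) +
      (\<Sum>r=1..card (exposed P). of_bool (r = Suc v \<and> card P = Suc v + j)))"
    by (subst sum_nc_partitions_Suc[of "\<lambda>r k. of_bool (r = Suc v \<and> k = Suc v + j)"]) simp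
  also have "\<dots> = (\<Sum>P\<in>?N. of_bool (card (exposed P) = v \<and> card P = v + j) +
      (\<Sum>i\<le>j. of_bool (card (exposed P) = Suc v + i \<and> card P = (Suc v + i) + (j - i))))"
  proof (rule sum.cong[OF refl], rule arg_cong2[where f = "(+)", OF refl])
    fix P assume P: "P \<in> ?N"
    let ?e = "card (exposed P)"
    have "(\<Sum>r=1..?e. of_bool (r = Suc v \<and> card P = Suc v + j)) =
        (of_bool (Suc v \<le> ?e \<and> card P = Suc v + j) :: nat)"
    proof (cases "card P = Suc v + j")
      case True
      then show ?thesis by (simp add: of_bool_def)
    qed simp
    also have "\<dots> = (\<Sum>i\<le>j. of_bool (?e = Suc v + i \<and> card P = (Suc v + i) + (j - i)))"
    proof (cases "Suc v \<le> ?e \<and> card P = Suc v + j")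
      case True
      have "(\<Sum>i\<le>j. of_bool (?e = Suc v + i \<and> card P = (Suc v + i) + (j - i)) :: nat) =
          (\<Sum>i\<le>j. of_bool (i = ?e - Suc v))"
        using True by (intro sum.cong refl) auto
      moreover have "?e - Suc v \<le> j" using card_exposed_le[OF P] True by linarith
      ultimately show ?thesis using True by (simp add: of_bool_def)
    next
      case False
      then show ?thesis by (auto intro!: sum.neutral[symmetric])
    qed
    finally show "(\<Sum>r=1..?e. of_bool (r = Suc v \<and> card P = Suc v + j)) =
        ((\<Sum>i\<le>j. of_bool (?e = Suc v + i \<and> card P = (Suc v + i) + (j - i))) :: nat)" .
  qed
  also have "\<dots> = nc_count n v j + (\<Sum>i\<le>j. nc_count n (Suc v + i) (j - i))"
    unfolding nc_count_def sum.distrib card_filter_eq_sum[OF finite_nc_partitions]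
    by (subst (2) sum.swap) simp
  finally show ?thesis .
qed

lemma nc_count_1: "nc_count 1 v j = of_bool (v = 1 \<and> j = 0)"
proof -
  have "nc_count 1 v j =
      (\<Sum>P\<in>nc_partitions (Suc 0). of_bool (card (exposed P) = v \<and> card P = v + j))"
    by (simp only: nc_count_def card_filter_eq_sum finite_nc_partitions One_nat_def)
  also have "\<dots> = of_bool (v = 1 \<and> j = 0)"
    by (subst sum_nc_partitions_Suc[of "\<lambda>r k. of_bool (r = v \<and> k = v + j)"])
       (auto simp: nc_partitions_0 exposed_def)
  finally show ?thesis .
qed

text \<open>
  The sum arising when the closed form is inserted into the recurrence. Splitting off its first term
  leaves the same sum for \<open>v + 1\<close> and \<open>j - 1\<close>, and two uses of Pascal's rule close the induction.
\<close>
lemma sum_weighted_diagonal_binomials: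
  assumes "v + j \<le> n"
  shows "(\<Sum>i\<le>j. (v + i) * ((n - (v + i) - 1) choose (j - i))) =
    v * ((n - v) choose j) + (if j = 0 then 0 else (n - v) choose (j - 1))"
  using assms
proof (induction j arbitrary: v)
  case 0
  then show ?case by simp
next
  case (Suc j)
  define m where "m = n - Suc v"
  have m: "n - v = Suc m" using Suc.prems by (simp add: m_def)
  have "(\<Sum>i\<le>Suc j. (v + i) * ((n - (v + i) - 1) choose (Suc j - i))) =
      v * (m choose Suc j) + (\<Sum>i\<le>j. (Suc v + i) * ((n - (Suc v + i) - 1) choose (j - i)))"
    by (simp add: sum.atMost_Suc_shift m_def del: sum.atMost_Suc)
  also have "\<dots> = v * (m choose Suc j) + (Suc v * (m choose j) + (if j = 0 then 0 else m choose (j - 1)))"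
    using Suc.prems by (subst Suc.IH) (auto simp: m_def)
  also have "\<dots> = v * ((n - v) choose Suc j) + ((n - v) choose j)"
    unfolding m by (cases j) (auto simp: algebra_simps)
  finally show ?case by simp
qed

text \<open>
  The algebra of the induction step. All binomials involved are rational multiples of
  \<open>n choose (Suc v + j)\<close> and \<open>(n - Suc v) choose j\<close>; after dividing these out, a polynomial identity
  remains.
\<close>
lemma nc_count_closed_form_step:
  fixes n v j :: nat
  assumes "Suc v + j \<le> n"
  shows "n * (Suc v * (Suc n choose (Suc v + j)) * ((n - Suc v) choose j)) =
    Suc n * (v * (n choose (v + j)) * ((n - Suc v) choose j) + (n choose (Suc v + j)) *
      (Suc v * ((n - Suc v) choose j) + (if j = 0 then 0 else (n - Suc v) choose (j - 1))))"
proof -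
  define q where "q = n - (v + j)"
  have n: "n = q + v + j" and q: "q > 0" using assms by (auto simp: q_def)
  define A where "A = real (n choose (v + j))"
  define B where "B = real (n choose (Suc v + j))"
  define D where "D = real ((n - Suc v) choose j)"
  define E where "E = real (if j = 0 then 0 else (n - Suc v) choose (j - 1))"
  have "Suc (v + j) * (n choose Suc (v + j)) = (n - (v + j)) * (n choose (v + j))"
    by (metis binomial_absorb_comp binomial_absorption)
  then have AB: "real (Suc v + j) * B = real q * A"
    unfolding A_def B_def q_def by (metis add_Suc of_nat_mult)
  have ED: "real q * E = real j * D"
  proof (cases j)
    case (Suc i)
    have "Suc i * ((n - Suc v) choose Suc i) = (n - Suc v - i) * ((n - Suc v) choose i)"
      by (metis binomial_absorb_comp binomial_absorption)
    moreover have "n - Suc v - i = q" using n Suc by simp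
    ultimately have "j * ((n - Suc v) choose j) = q * ((n - Suc v) choose i)"
      using Suc by simp
    moreover have "E = real ((n - Suc v) choose i)" using Suc by (simp add: E_def)
    ultimately show ?thesis unfolding D_def by (metis of_nat_mult)
  qed (simp add: E_def)
  have pascal: "real (Suc n choose (Suc v + j)) = A + B"
    by (simp add: A_def B_def)
  have A: "A = real (Suc v + j) * B / real q" and E: "E = real j * D / real q"
    using AB ED q by (simp_all add: field_simps)
  have "real n * (real (Suc v) * (A + B) * D) =
      real (Suc n) * (real v * A * D + B * (real (Suc v) * D + E))"
    unfolding A E n using q by (simp add: field_simps)
  then have "real (n * (Suc v * (Suc n choose (Suc v + j)) * ((n - Suc v) choose j))) =
    real (Suc n * (v * (n choose (v + j)) * ((n - Suc v) choose j) + (n choose (Suc v + j)) *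
      (Suc v * ((n - Suc v) choose j) + (if j = 0 then 0 else (n - Suc v) choose (j - 1)))))"
    unfolding of_nat_mult of_nat_add pascal A_def[symmetric] B_def[symmetric] D_def[symmetric]
      E_def[symmetric] .
  then show ?thesis by (simp only: of_nat_eq_iff)
qed

text \<open>
  For \<open>v = n\<close> the truncated difference \<open>n - v - 1\<close> is \<open>0\<close>, and then \<open>j = 0\<close> gives the correct value \<open>1\<close> for
  the partition into singletons.
\<close>
lemma nc_count_closed_form:
  assumes "n \<ge> 1"
  shows "n * nc_count n v j = v * (n choose (v + j)) * ((n - v - 1) choose j)"
  using assms
proof (induction n arbitrary: v j rule: dec_induct)
  case base
  consider "v = 0" | "v = 1" "j = 0" | "v = 1" "j > 0" | "v \<ge> 2" by linarith
  then show ?case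
    unfolding nc_count_1 by cases (auto simp: binomial_eq_0)
next
  case (step n)
  show ?case
  proof (cases v)
    case 0
    then show ?thesis by (simp add: nc_count_Suc_0)
  next
    case (Suc w)
    have "n * nc_count (Suc n) (Suc w) j = n * nc_count n w j +
        (\<Sum>i\<le>j. n * nc_count n (Suc w + i) (j - i))"
      by (simp only: nc_count_Suc_Suc distrib_left sum_distrib_left)
    also have "(\<Sum>i\<le>j. n * nc_count n (Suc w + i) (j - i)) =
        (\<Sum>i\<le>j. (n choose (Suc w + j)) * ((Suc w + i) * ((n - (Suc w + i) - 1) choose (j - i))))"
      using step.IH by (intro sum.cong refl) (simp add: algebra_simps)
    also have "\<dots> = (n choose (Suc w + j)) * (\<Sum>i\<le>j. (Suc w + i) * ((n - (Suc w + i) - 1) choose (j - i)))"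
      by (simp only: sum_distrib_left)
    finally have rec: "n * nc_count (Suc n) (Suc w) j =
        w * (n choose (w + j)) * ((n - Suc w) choose j) +
        (n choose (Suc w + j)) * (\<Sum>i\<le>j. (Suc w + i) * ((n - (Suc w + i) - 1) choose (j - i)))"
      using step.IH by simp
    have "n * (Suc n * nc_count (Suc n) (Suc w) j) =
        n * (Suc w * (Suc n choose (Suc w + j)) * ((n - Suc w) choose j))"
    proof (cases "Suc w + j \<le> n")
      case True
      have "n * (Suc n * nc_count (Suc n) (Suc w) j) = Suc n * (n * nc_count (Suc n) (Suc w) j)"
        by (rule mult.left_commute)
      then show ?thesis
        unfolding rec sum_weighted_diagonal_binomials[OF True] nc_count_closed_form_step[OF True] .
    next
      case False
      then have zero: "n choose (Suc w + j) = 0" by (simp add: binomial_eq_0)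
      show ?thesis
      proof (cases "j = 0 \<and> w = n")
        case True
        then have "n * nc_count (Suc n) (Suc w) j = n" using rec by (simp add: binomial_eq_0)
        then show ?thesis using True by (simp only: mult.left_commute[of n "Suc n"]) simp
      next
        case F: False
        then have "(n choose (w + j)) * ((n - Suc w) choose j) = 0"
          using False by (cases "w + j > n") (auto simp: binomial_eq_0)
        moreover have "(Suc n choose (Suc w + j)) * ((n - Suc w) choose j) = 0"
          using False F by (cases "w + j > n") (auto simp: binomial_eq_0)
        ultimately show ?thesis using rec zero
          by (simp only: mult.assoc mult.left_commute[of n "Suc n"]) simp
      qed
    qed
    then show ?thesis using step.hyps Suc by simp
  qed
qed

text \<open>
  Summing over the number of exposed blocks. This is the diagonal sum of binomials once more, started at
  \<open>v = 1\<close>, as the block of \<open>n\<close> is always exposed.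
\<close>
lemma narayana_count:
  assumes "n \<ge> 1"
  shows "n * card {P \<in> nc_partitions n. card P = Suc k} = (n choose Suc k) * (n choose k)"
proof -
  obtain n' where n: "n = Suc n'" using assms by (cases n) auto
  have "{P \<in> nc_partitions n. card P = Suc k} =
      (\<Union>v\<le>Suc k. {P \<in> nc_partitions n. card (exposed P) = v \<and> card P = v + (Suc k - v)})"
    by (auto, drule card_exposed_le, simp)
  then have "card {P \<in> nc_partitions n. card P = Suc k} = (\<Sum>v\<le>Suc k. nc_count n v (Suc k - v))"
    unfolding nc_count_def
    by (simp only:) (rule card_UN_disjoint, auto simp: finite_nc_partitions)
  also have "\<dots> = (\<Sum>i\<le>k. nc_count n (1 + i) (k - i))"
    by (simp add: sum.atMost_Suc_shift n nc_count_Suc_0 del: sum.atMost_Suc)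
  finally have "n * card {P \<in> nc_partitions n. card P = Suc k} =
      (\<Sum>i\<le>k. n * nc_count n (1 + i) (k - i))"
    by (simp only: sum_distrib_left)
  also have "\<dots> = (\<Sum>i\<le>k. (n choose Suc k) * ((1 + i) * ((n - (1 + i) - 1) choose (k - i))))"
    using nc_count_closed_form[OF assms] by (intro sum.cong refl) (simp add: algebra_simps)
  also have "\<dots> = (n choose Suc k) * (\<Sum>i\<le>k. (1 + i) * ((n - (1 + i) - 1) choose (k - i)))"
    by (simp only: sum_distrib_left)
  also have "\<dots> = (n choose Suc k) * (n choose k)"
  proof (cases "1 + k \<le> n")
    case True
    note sum_weighted_diagonal_binomials[OF True]
    also have "1 * ((n - 1) choose k) + (if k = 0 then 0 else (n - 1) choose (k - 1)) = n choose k"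
      by (cases k) (simp_all add: n)
    finally show ?thesis by simp
  qed (simp add: binomial_eq_0)
  finally show ?thesis .
qed

section \<open>The hypergeometric law of the number of blocks\<close>

text \<open>
  The Narayana count rewritten by the symmetry of the binomial coefficients, so that the sum over \<open>k\<close>
  becomes a Vandermonde convolution. It includes \<open>k = 0\<close>, where both sides vanish.
\<close>
lemma card_nc_partitions_blocks:
  assumes "n \<ge> 1" "k \<le> Suc n"
  shows "n * card {P \<in> nc_partitions n. card P = k} = (n choose k) * (n choose (Suc n - k))"
proof (cases k)
  case 0
  have "card P \<noteq> 0" if "P \<in> nc_partitions n" for P
    using nc_partitions_Union[OF that] nc_partitions_finite[OF that] assms by auto
  then have empty: "{P \<in> nc_partitions n. card P = k} = {}" using 0 by auto
  show ?thesis unfolding empty using 0 by simp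
next
  case (Suc i)
  then show ?thesis
    using narayana_count[OF assms(1), of i] binomial_symmetric[of i n] assms(2) by simp
qed

lemma card_le_nc_partitions:
  assumes "n \<ge> 1" "P \<in> nc_partitions n"
  shows "card P \<le> n"
proof (rule ccontr)
  assume "\<not> card P \<le> n"
  then obtain k where k: "card P = Suc k" "Suc k > n" by (cases "card P") auto
  then have "n * card {P \<in> nc_partitions n. card P = Suc k} = 0"
    using narayana_count[OF assms(1), of k] by (simp add: binomial_eq_0)
  then have "{P \<in> nc_partitions n. card P = Suc k} = {}"
    using assms(1) finite_nc_partitions by simp
  then show False using assms(2) k by blast
qed

lemma card_nc_partitions:
  assumes "n \<ge> 1"
  shows "n * card (nc_partitions n) = 2 * n choose Suc n"
proof -
  have "card (nc_partitions n) = (\<Sum>k\<le>Suc n. card {P \<in> nc_partitions n. card P = k})"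
    using sum.group[of "nc_partitions n" "{..Suc n}" card "\<lambda>_. 1 :: nat"]
      finite_nc_partitions card_le_nc_partitions[OF assms] le_SucI by (simp add: image_subset_iff)
  then have "n * card (nc_partitions n) = (\<Sum>k\<le>Suc n. n * card {P \<in> nc_partitions n. card P = k})"
    by (simp only: sum_distrib_left)
  also have "\<dots> = (\<Sum>k\<le>Suc n. (n choose k) * (n choose (Suc n - k)))"
    by (intro sum.cong refl card_nc_partitions_blocks[OF assms]) simp
  also have "\<dots> = 2 * n choose Suc n"
    by (simp only: vandermonde mult_2)
  finally show ?thesis .
qed

text \<open>
  The probability that \<open>n + 1\<close> balls drawn without replacement from \<open>n\<close> marked and \<open>n\<close> unmarked ones
  contain exactly \<open>k\<close> marked balls.
\<close>
definition hypergeom :: "nat \<Rightarrow> nat \<Rightarrow> real" where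
  "hypergeom n k = real ((n choose k) * (n choose (Suc n - k))) / real (2 * n choose Suc n)"

lemma expectation_num_blocks:
  fixes g :: "real \<Rightarrow> 'a::{banach, second_countable_topology}"
  assumes "n \<ge> 1"
  shows "measure_pmf.expectation (random_nc_partition n) (\<lambda>P. g (num_blocks P)) =
    (\<Sum>k\<le>Suc n. hypergeom n k *\<^sub>R g (real k))"
proof -
  let ?N = "nc_partitions n"
  have le: "card P \<le> Suc n" if "P \<in> ?N" for P
    using card_le_nc_partitions[OF assms that] by simp
  have "measure_pmf.expectation (random_nc_partition n) (\<lambda>P. g (num_blocks P)) =
      (\<Sum>P\<in>?N. (1 / card ?N) *\<^sub>R g (card P))"
    unfolding random_nc_partition_def
    using finite_nc_partitions nc_partitions_nonempty
    by (subst integral_measure_pmf[of ?N]) (auto simp: num_blocks_def)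
  also have "\<dots> = (\<Sum>k\<le>Suc n. \<Sum>P | P \<in> ?N \<and> card P = k. (1 / card ?N) *\<^sub>R g (card P))"
    using finite_nc_partitions le by (subst sum.group) (auto simp: image_subset_iff)
  also have "\<dots> = (\<Sum>k\<le>Suc n. hypergeom n k *\<^sub>R g (real k))"
  proof (rule sum.cong[OF refl])
    fix k assume "k \<in> {..Suc n}"
    then have "hypergeom n k = real (card {P \<in> ?N. card P = k}) / card ?N"
      using card_nc_partitions_blocks[OF assms, of k, symmetric] assms
      by (simp add: hypergeom_def card_nc_partitions[OF assms, symmetric])
    moreover have "(\<Sum>P | P \<in> ?N \<and> card P = k. (1 / card ?N) *\<^sub>R g (card P)) =
        (\<Sum>P | P \<in> ?N \<and> card P = k. (1 / card ?N) *\<^sub>R g (real k))"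
      by (rule sum.cong) auto
    ultimately show "(\<Sum>P | P \<in> ?N \<and> card P = k. (1 / card ?N) *\<^sub>R g (card P)) =
        hypergeom n k *\<^sub>R g (real k)"
      by (simp add: sum_constant_scaleR)
  qed
  finally show ?thesis .
qed

lemma sum_hypergeom:
  assumes "n \<ge> 1"
  shows "(\<Sum>k\<le>Suc n. hypergeom n k) = 1"
proof -
  have "2 * n choose Suc n \<noteq> 0" using assms by (simp add: binomial_eq_0_iff)
  moreover have "(\<Sum>k\<le>Suc n. (n choose k) * (n choose (Suc n - k))) = 2 * n choose Suc n"
    by (simp only: vandermonde mult_2)
  ultimately show ?thesis
    unfolding hypergeom_def sum_divide_distrib[symmetric] of_nat_sum[symmetric] by simp
qed

text \<open>
  The weights are symmetric under \<open>k \<mapsto> n + 1 - k\<close>, so the mean is the centre of symmetry.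
\<close>
lemma sum_hypergeom_index:
  assumes "n \<ge> 1"
  shows "(\<Sum>k\<le>Suc n. hypergeom n k * real k) = (real n + 1) / 2"
proof -
  have sym: "hypergeom n (Suc n - k) = hypergeom n k" if "k \<le> Suc n" for k
    using that by (simp add: hypergeom_def mult.commute)
  define S where "S = (\<Sum>k\<le>Suc n. hypergeom n k * real k)"
  have "S = (\<Sum>k\<le>Suc n. hypergeom n (Suc n - k) * real (Suc n - k))"
    using sum.atLeastAtMost_rev[of "\<lambda>k. hypergeom n k * real k" 0 "Suc n"]
    by (simp add: S_def atMost_atLeast0 del: sum.cl_ivl_Suc)
  also have "\<dots> = (\<Sum>k\<le>Suc n. (real n + 1) * hypergeom n k - hypergeom n k * real k)"
    by (intro sum.cong refl) (simp add: sym of_nat_diff algebra_simps)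
  also have "\<dots> = (real n + 1) - S"
    by (simp only: S_def sum_subtractf sum_distrib_left[symmetric] sum_hypergeom[OF assms] mult_1_right)
  finally have "S = (real n + 1) / 2" by simp
  then show ?thesis by (simp only: S_def)
qed

text \<open>
  For the variance the mixed moment of \<open>k\<close> and \<open>n + 1 - k\<close> is more convenient than the second moment:
  each factor is absorbed by one of the two binomials, and what is left is a Vandermonde sum again.
\<close>
lemma sum_hypergeom_index_complement:
  assumes "n \<ge> 1"
  shows "(\<Sum>k\<le>Suc n. hypergeom n k * (real k * real (Suc n - k))) =
    (real n)\<^sup>2 * (real n + 1) / (2 * (2 * real n - 1))"
proof -
  obtain m where n: "n = Suc m" using assms by (cases n) auto
  have "(\<Sum>k\<le>Suc n. ((n choose k) * (n choose (Suc n - k))) * (k * (Suc n - k))) =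
      (\<Sum>i\<le>n. (Suc i * (n choose Suc i)) * ((n - i) * (n choose (n - i))))"
    by (simp add: sum.atMost_Suc_shift algebra_simps del: sum.atMost_Suc)
  also have "\<dots> = (\<Sum>i\<le>m. (Suc i * (n choose Suc i)) * ((n - i) * (n choose (n - i))))"
    by (simp add: n)
  also have "\<dots> = (\<Sum>i\<le>m. n\<^sup>2 * ((m choose i) * (m choose (m - i))))"
  proof (intro sum.cong refl)
    fix i assume "i \<in> {..m}"
    then have i: "n - i = Suc (m - i)" by (simp add: n Suc_diff_le)
    show "(Suc i * (n choose Suc i)) * ((n - i) * (n choose (n - i))) =
        n\<^sup>2 * ((m choose i) * (m choose (m - i)))"
      unfolding i unfolding n using Suc_times_binomial_eq[of m i] Suc_times_binomial_eq[of m "m - i"]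
      by (metis (no_types, lifting) mult.assoc mult.commute mult.left_commute power2_eq_square)
  qed
  also have "\<dots> = n\<^sup>2 * (2 * m choose m)"
    by (simp only: sum_distrib_left[symmetric] vandermonde mult_2)
  finally have num: "(\<Sum>k\<le>Suc n. ((n choose k) * (n choose (Suc n - k))) * (k * (Suc n - k))) =
    n\<^sup>2 * (2 * m choose m)" .
  have "(2 * n choose Suc n) * Suc n = 2 * n * (Suc (2 * m) choose Suc m)"
    using Suc_times_binomial_eq[of "Suc (2 * m)" n] by (simp add: n)
  also have "\<dots> = 2 * ((Suc (2 * m) choose Suc m) * Suc m)"
    by (simp only: n mult_ac)
  also have "(Suc (2 * m) choose Suc m) * Suc m = Suc (2 * m) * (2 * m choose m)"
    by (simp only: Suc_times_binomial_eq[of "2 * m" m])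
  finally have "(2 * n choose Suc n) * Suc n = 2 * (Suc (2 * m) * (2 * m choose m))" .
  then have "real (2 * n choose Suc n) * (real n + 1) = 2 * (2 * real n - 1) * real (2 * m choose m)"
    unfolding of_nat_eq_iff[where 'a = real, symmetric] by (simp add: n algebra_simps)
  moreover have "real (2 * n choose Suc n) > 0" using assms by simp
  moreover have "2 * real n - 1 > 0" using assms by simp
  ultimately have ratio: "real (2 * m choose m) / real (2 * n choose Suc n) = (real n + 1) / (2 * (2 * real n - 1))"
    by (simp add: frac_eq_eq mult_ac)
  have "(\<Sum>k\<le>Suc n. hypergeom n k * (real k * real (Suc n - k))) =
      real (\<Sum>k\<le>Suc n. ((n choose k) * (n choose (Suc n - k))) * (k * (Suc n - k))) / real (2 * n choose Suc n)"
    unfolding hypergeom_def by (simp only: of_nat_sum sum_divide_distrib of_nat_mult times_divide_eq_left)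
  also have "\<dots> = (real n)\<^sup>2 * (real (2 * m choose m) / real (2 * n choose Suc n))"
    unfolding num by simp
  finally show ?thesis by (simp add: ratio)
qed

lemma mean_blocks_eq:
  assumes "n \<ge> 1"
  shows "mean_blocks n = (real n + 1) / 2"
  using expectation_num_blocks[OF assms, of "\<lambda>x. x"] sum_hypergeom_index[OF assms]
  by (simp add: mean_blocks_def)

lemma var_blocks_eq:
  assumes "n \<ge> 1"
  shows "var_blocks n = ((real n)\<^sup>2 - 1) / (4 * (2 * real n - 1))"
proof -
  define \<mu> where "\<mu> = (real n + 1) / 2"
  have "var_blocks n = (\<Sum>k\<le>Suc n. hypergeom n k * (real k - \<mu>)\<^sup>2)"
    unfolding var_blocks_def mean_blocks_def[symmetric] mean_blocks_eq[OF assms] \<mu>_def[symmetric]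
    by (subst expectation_num_blocks[OF assms, of "\<lambda>x. (x - \<mu>)\<^sup>2"]) simp
  also have "\<dots> = (\<Sum>k\<le>Suc n. \<mu>\<^sup>2 * hypergeom n k - hypergeom n k * (real k * real (Suc n - k)))"
    by (intro sum.cong refl) (simp add: \<mu>_def of_nat_diff field_simps power2_eq_square)
  also have "\<dots> = \<mu>\<^sup>2 - (real n)\<^sup>2 * (real n + 1) / (2 * (2 * real n - 1))"
    by (simp only: sum_subtractf sum_distrib_left[symmetric] sum_hypergeom[OF assms]
        sum_hypergeom_index_complement[OF assms] mult_1_right)
  also have "\<dots> = ((real n)\<^sup>2 - 1) / (4 * (2 * real n - 1))"
    using assms by (simp add: \<mu>_def field_simps power2_eq_square)
  finally show ?thesis .
qed

section \<open>A Fourier integral for the characteristic function\<close>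

lemma has_bochner_integral_iexp_int:
  fixes m :: int
  shows "has_bochner_integral lborel (\<lambda>u. indicator {-pi..pi} u *\<^sub>R iexp (of_int m * u)) (if m = 0 then 2 * pi else 0)"
proof (cases "m = 0")
  case True
  have "has_bochner_integral lborel (\<lambda>u. indicator {-pi..pi} u *\<^sub>R (1::complex)) (measure lborel {-pi..pi} *\<^sub>R 1)"
    by (rule has_bochner_integral_indicator) (auto simp: emeasure_lborel_Icc_eq)
  then show ?thesis using True by (simp add: scaleR_conv_of_real)
next
  case False
  define F where "F u = iexp (of_int m * u) / (\<i> * of_int m)" for u
  have "has_bochner_integral lborel (\<lambda>u. indicator {-pi..pi} u *\<^sub>R iexp (of_int m * u)) (F pi - F (- pi))"
  proof (rule has_bochner_integral_FTC_Icc)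
    show "(F has_vector_derivative iexp (of_int m * u)) (at u within {-pi..pi})" for u
      unfolding F_def using False
      by (auto intro!: derivative_eq_intros has_vector_derivative_real_field simp: field_simps)
    show "continuous_on {-pi..pi} (\<lambda>u. iexp (of_int m * u))"
      by (intro continuous_intros)
  qed simp
  moreover have "F pi = F (- pi)"
  proof -
    have "iexp (of_int m * pi) = iexp (of_int m * (-pi)) * exp (2 * of_int m * of_real pi * \<i>)"
      unfolding exp_add[symmetric] by (rule arg_cong[where f = exp]) (simp add: algebra_simps)
    also have "exp (2 * of_int m * of_real pi * \<i>) = 1" by (simp add: exp_eq_1)
    finally show ?thesis unfolding F_def mult_1_right by (rule arg_cong)
  qed
  ultimately show ?thesis using False by simp
qed

text \<open>
  Up to a constant factor, this is the first Fourier coefficient of \<open>(2 cos u + 2 cos (s/2))^n\<close>. The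
  division by \<open>2\<close> makes the base equal to \<open>1\<close> at \<open>u = s = 0\<close>, where the mass concentrates for large \<open>n\<close>.
\<close>
definition cos_kernel :: "nat \<Rightarrow> real \<Rightarrow> complex" where
  "cos_kernel n s = (\<integral>u. indicator {-pi..pi} u *\<^sub>R (of_real (((cos u + cos (s / 2)) / 2) ^ n) * iexp (- u)) \<partial>lborel)"

text \<open>
  The base of the power in the kernel factors as \<open>(2 cos a) (2 cos b)\<close> with \<open>a = u/2 + s/4\<close> and
  \<open>b = u/2 - s/4\<close>. In the product of the two binomial expansions the summand with indices \<open>j\<close> and \<open>l\<close> has
  frequency \<open>j + l - n\<close> in \<open>u\<close> and phase \<open>s (j - l) / 2\<close>. Integration against \<open>exp (-i u)\<close> keeps only
  \<open>j + l = n + 1\<close>.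
\<close>
lemma binomial_convolution_Fourier:
  "(\<Sum>k\<le>Suc n. of_nat ((n choose k) * (n choose (Suc n - k))) * iexp (s * (real k - (real n + 1) / 2))) * (2 * pi) =
    4 ^ n * cos_kernel n s"
proof -
  let ?a = "\<lambda>u. u / 2 + s / 4" and ?b = "\<lambda>u. u / 2 - s / 4"
  let ?t = "\<lambda>u j l. (of_nat ((n choose j) * (n choose l)) * iexp (s * (real j - real l) / 2)) *
    iexp (of_int (int j + int l - int n - 1) * u)"
  have two_cos: "of_real (2 * cos x) = iexp x + iexp (- x)" for x :: real
    by (simp add: cos_of_real[symmetric] cos_exp_eq)
  have binom: "of_real (2 * cos x) ^ n = (\<Sum>j\<le>n. of_nat (n choose j) * iexp ((2 * real j - real n) * x))" for x
  proof -
    have "of_real (2 * cos x) ^ n = (\<Sum>j\<le>n. of_nat (n choose j) * iexp x ^ j * iexp (- x) ^ (n - j))"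
      unfolding two_cos by (rule binomial_ring)
    also have "\<dots> = (\<Sum>j\<le>n. of_nat (n choose j) * iexp ((2 * real j - real n) * x))"
    proof (intro sum.cong refl)
      fix j assume "j \<in> {..n}"
      then have "iexp x ^ j * iexp (- x) ^ (n - j) = iexp ((2 * real j - real n) * x)"
        unfolding exp_of_nat_mult[symmetric] exp_add[symmetric]
        by (intro arg_cong[where f = exp]) (simp add: of_nat_diff algebra_simps)
      then show "of_nat (n choose j) * iexp x ^ j * iexp (- x) ^ (n - j) =
          of_nat (n choose j) * iexp ((2 * real j - real n) * x)" by (simp only: mult.assoc)
    qed
    finally show ?thesis .
  qed
  have integrand: "4 ^ n * (of_real (((cos u + cos (s / 2)) / 2) ^ n) * iexp (- u)) = (\<Sum>j\<le>n. \<Sum>l\<le>n. ?t u j l)" for u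
  proof -
    have "4 * ((cos u + cos (s / 2)) / 2) = (2 * cos (?a u)) * (2 * cos (?b u))"
      using cos_plus_cos[of u "s / 2"] by (simp add: add_divide_distrib diff_divide_distrib)
    then have "4 ^ n * complex_of_real (((cos u + cos (s / 2)) / 2) ^ n) =
        of_real (2 * cos (?a u)) ^ n * of_real (2 * cos (?b u)) ^ n"
      by (metis of_real_mult of_real_numeral of_real_power power_mult_distrib)
    also have "\<dots> = (\<Sum>j\<le>n. \<Sum>l\<le>n. (of_nat (n choose j) * iexp ((2 * real j - real n) * ?a u)) *
        (of_nat (n choose l) * iexp ((2 * real l - real n) * ?b u)))"
      unfolding binom by (rule sum_product)
    finally have "4 ^ n * (of_real (((cos u + cos (s / 2)) / 2) ^ n) * iexp (- u)) =
      (\<Sum>j\<le>n. \<Sum>l\<le>n. (of_nat (n choose j) * iexp ((2 * real j - real n) * ?a u)) *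
        (of_nat (n choose l) * iexp ((2 * real l - real n) * ?b u)) * iexp (- u))"
      by (simp only: mult.assoc[symmetric] sum_distrib_right)
    also have "\<dots> = (\<Sum>j\<le>n. \<Sum>l\<le>n. ?t u j l)"
    proof (intro sum.cong refl)
      fix j l
      have "iexp ((2 * real j - real n) * ?a u) * iexp ((2 * real l - real n) * ?b u) * iexp (- u) =
          iexp (s * (real j - real l) / 2) * iexp (of_int (int j + int l - int n - 1) * u)"
        unfolding exp_add[symmetric] by (intro arg_cong[where f = exp]) (simp add: field_simps)
      then show "(of_nat (n choose j) * iexp ((2 * real j - real n) * ?a u)) *
          (of_nat (n choose l) * iexp ((2 * real l - real n) * ?b u)) * iexp (- u) = ?t u j l"
        by (simp only: of_nat_mult mult.assoc mult.left_commute)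
    qed
    finally show ?thesis .
  qed
  define A where "A j l = (of_nat ((n choose j) * (n choose l)) * iexp (s * (real j - real l) / 2)) *
    (if int j + int l - int n - 1 = 0 then 2 * pi else 0 :: complex)" for j l
  have "has_bochner_integral lborel (\<lambda>u. indicator {-pi..pi} u *\<^sub>R ?t u j l) (A j l)" for j l
    using has_bochner_integral_mult_right[OF has_bochner_integral_iexp_int]
    unfolding A_def mult_scaleR_right[symmetric] .
  then have "has_bochner_integral lborel (\<lambda>u. indicator {-pi..pi} u *\<^sub>R (\<Sum>j\<le>n. \<Sum>l\<le>n. ?t u j l)) (\<Sum>j\<le>n. \<Sum>l\<le>n. A j l)"
    unfolding scaleR_sum_right by (intro has_bochner_integral_sum) auto
  then have "(\<integral>u. 4 ^ n * (indicator {-pi..pi} u *\<^sub>R (of_real (((cos u + cos (s / 2)) / 2) ^ n) * iexp (- u))) \<partial>lborel) =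
      (\<Sum>j\<le>n. \<Sum>l\<le>n. A j l)"
    unfolding integrand[symmetric] mult_scaleR_right[symmetric] by (rule has_bochner_integral_integral_eq)
  then have "4 ^ n * cos_kernel n s = (\<Sum>j\<le>n. \<Sum>l\<le>n. A j l)"
    unfolding cos_kernel_def by (simp only: integral_mult_right_zero)
  also have "\<dots> = (\<Sum>j\<le>n. of_nat ((n choose j) * (n choose (Suc n - j))) * iexp (s * (real j - (real n + 1) / 2)) * (2 * pi))"
  proof (intro sum.cong refl)
    fix j assume j: "j \<in> {..n}"
    have "(\<Sum>l\<le>n. A j l) = (\<Sum>l\<le>n. if l = Suc n - j then
        of_nat ((n choose j) * (n choose (Suc n - j))) * iexp (s * (real j - real (Suc n - j)) / 2) * (2 * pi) else 0)"
      using j unfolding A_def by (intro sum.cong refl) (auto split: if_splits)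
    also have "\<dots> = of_nat ((n choose j) * (n choose (Suc n - j))) * iexp (s * (real j - real (Suc n - j)) / 2) * (2 * pi)"
      by (simp add: binomial_eq_0)
    also have "s * (real j - real (Suc n - j)) / 2 = s * (real j - (real n + 1) / 2)"
      using j by (simp add: of_nat_diff field_simps)
    finally show "(\<Sum>l\<le>n. A j l) = of_nat ((n choose j) * (n choose (Suc n - j))) * iexp (s * (real j - (real n + 1) / 2)) * (2 * pi)" .
  qed
  also have "\<dots> = (\<Sum>k\<le>Suc n. of_nat ((n choose k) * (n choose (Suc n - k))) * iexp (s * (real k - (real n + 1) / 2))) * (2 * pi)"
    by (simp add: binomial_eq_0 sum_distrib_right)
  finally show ?thesis by simp
qed

text \<open>
  The normalization \<open>2 * n choose Suc n\<close> of the hypergeometric weights is the Fourier integral at \<open>s = 0\<close>,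
  up to the same constant factor as for the other \<open>s\<close>, so the quotient needs no asymptotics of binomial coefficients.
\<close>
lemma char_standardized_blocks:
  assumes "n \<ge> 1"
  shows "char (distr (measure_pmf (random_nc_partition n)) borel (standardized_blocks n)) t =
    cos_kernel n (t / sqrt (var_blocks n)) / cos_kernel n 0"
proof -
  let ?\<sigma> = "sqrt (var_blocks n)" and ?C = "real (2 * n choose Suc n)"
  define \<mu> where "\<mu> = (real n + 1) / 2"
  have C: "?C \<noteq> 0" using assms by (simp add: binomial_eq_0_iff)
  have series: "4 ^ n * cos_kernel n s = of_real (?C * (2 * pi)) * (\<Sum>k\<le>Suc n. hypergeom n k *\<^sub>R iexp (s * (real k - \<mu>)))" for s
  proof -
    have "(\<Sum>k\<le>Suc n. of_nat ((n choose k) * (n choose (Suc n - k))) * iexp (s * (real k - \<mu>))) =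
        of_real ?C * (\<Sum>k\<le>Suc n. hypergeom n k *\<^sub>R iexp (s * (real k - \<mu>)))"
      unfolding sum_distrib_left hypergeom_def using C
      by (intro sum.cong refl) (simp add: scaleR_conv_of_real)
    then show ?thesis
      unfolding binomial_convolution_Fourier[of n s, folded \<mu>_def, symmetric] of_real_mult by (simp only: mult_ac)
  qed
  have kernel_0: "4 ^ n * cos_kernel n 0 = of_real (?C * (2 * pi))"
    unfolding series using sum_hypergeom[OF assms]
    by (simp add: scaleR_conv_of_real of_real_sum[symmetric] del: sum.atMost_Suc of_real_sum)
  then have ratio: "cos_kernel n s / cos_kernel n 0 = (\<Sum>k\<le>Suc n. hypergeom n k *\<^sub>R iexp (s * (real k - \<mu>)))" for s
  proof -
    have "cos_kernel n s / cos_kernel n 0 = (4 ^ n * cos_kernel n s) / (4 ^ n * cos_kernel n 0)"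
      by simp
    also have "\<dots> = (\<Sum>k\<le>Suc n. hypergeom n k *\<^sub>R iexp (s * (real k - \<mu>)))"
      unfolding kernel_0 unfolding series using C by simp
    finally show ?thesis .
  qed
  have "char (distr (measure_pmf (random_nc_partition n)) borel (standardized_blocks n)) t =
      measure_pmf.expectation (random_nc_partition n) (\<lambda>P. iexp (t * ((num_blocks P - \<mu>) / ?\<sigma>)))"
    unfolding char_def by (subst integral_distr) (auto simp: standardized_blocks_def \<mu>_def mean_blocks_eq[OF assms])
  also have "\<dots> = (\<Sum>k\<le>Suc n. hypergeom n k *\<^sub>R iexp (t * ((real k - \<mu>) / ?\<sigma>)))"
    by (rule expectation_num_blocks[OF assms])
  also have "\<dots> = cos_kernel n (t / ?\<sigma>) / cos_kernel n 0"
    unfolding ratio by (simp add: mult_ac)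
  finally show ?thesis .
qed

section \<open>The Gaussian limit\<close>

lemma has_bochner_integral_gaussian:
  fixes a :: real
  assumes "a > 0"
  shows "has_bochner_integral lborel (\<lambda>v. exp (- v\<^sup>2 / a)) (sqrt (pi * a))"
proof -
  have "has_bochner_integral lborel (\<lambda>v. sqrt (pi * a) * normal_density 0 (sqrt (a / 2)) v) (sqrt (pi * a) * 1)"
    using assms integrable_normal_density[of "sqrt (a / 2)" 0] integral_normal_density[of "sqrt (a / 2)" 0]
    by (intro has_bochner_integral_mult_right) (auto simp: has_bochner_integral_iff)
  moreover have "sqrt (pi * a) * normal_density 0 (sqrt (a / 2)) v = exp (- v\<^sup>2 / a)" for v
    using assms by (simp add: normal_density_def)
  ultimately show ?thesis by simp
qed

text \<open>
  The fourth-order Taylor bound is too weak at \<open>\<bar>u\<bar> = pi\<close> when only \<open>pi < 4\<close> is used; so it is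
  applied to \<open>u / 2\<close> and carried over by the double angle formula.
\<close>
lemma cos_le_quadratic:
  fixes u :: real
  assumes "\<bar>u\<bar> \<le> pi"
  shows "cos u \<le> 1 - u\<^sup>2 / 8"
proof -
  define w where "w = u / 2"
  have w2: "w\<^sup>2 \<le> 4"
    using assms pi_less_4 abs_le_square_iff[of w 2] by (simp add: w_def)
  obtain t where t: "cos w = (\<Sum>m<4. cos_coeff m * w ^ m) + cos (t + 1/2 * real 4 * pi) / fact 4 * w ^ 4"
    using Maclaurin_cos_expansion[of w 4] by blast
  have "cos w \<le> 1 - w\<^sup>2 / 2 + w ^ 4 / 24"
  proof -
    have "cos (t + 1/2 * real 4 * pi) * w ^ 4 \<le> 1 * w ^ 4"
      by (intro mult_right_mono cos_le_one) simp
    moreover have "{..<4::nat} = {0, 1, 2, 3}" by auto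
    ultimately show ?thesis
      unfolding t by (simp add: cos_coeff_def fact_numeral)
  qed
  also have "w ^ 4 / 24 \<le> w\<^sup>2 / 6"
    using mult_right_mono[OF w2, of "w\<^sup>2"] by (simp add: power4_eq_xxxx power2_eq_square)
  finally have "cos w \<le> 1 - w\<^sup>2 / 3" by simp
  moreover have "0 \<le> cos w"
    using assms by (intro cos_ge_zero) (auto simp: w_def abs_le_iff)
  ultimately have "cos w * cos w \<le> (1 - w\<^sup>2 / 3) * 1"
    by (intro mult_mono) auto
  also have "\<dots> \<le> 1 - w\<^sup>2 / 4" by simp
  finally have "2 * (cos w * cos w) - 1 \<le> 1 - w\<^sup>2 / 2" by simp
  moreover have "cos u = 2 * (cos w)\<^sup>2 - 1"
    using cos_double_cos[of w] by (simp add: w_def)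
  ultimately show ?thesis by (simp add: w_def power_divide power2_eq_square)
qed

text \<open>
  The source of the dominating function: with \<open>u = v / sqrt n\<close>, the \<open>n\<close>-th power of the right-hand side is
  \<open>exp (-v^2/16)\<close>, independently of \<open>n\<close>. The base may be negative near \<open>\<bar>u\<bar> = pi\<close>, but is never
  below \<open>-1/4\<close>, which suffices because \<open>exp (-1) > 1/4\<close>.
\<close>
lemma half_cos_sum_bound:
  fixes u c :: real
  assumes u: "\<bar>u\<bar> \<le> pi" and c: "1/2 \<le> c" "c \<le> 1"
  shows "\<bar>(cos u + c) / 2\<bar> \<le> exp (- u\<^sup>2 / 16)"
proof -
  have "(cos u + c) / 2 \<le> 1 + (- u\<^sup>2 / 16)"
    using cos_le_quadratic[OF u] c by simp
  also have "\<dots> \<le> exp (- u\<^sup>2 / 16)" by (rule exp_ge_add_one_self)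
  finally have upper: "(cos u + c) / 2 \<le> exp (- u\<^sup>2 / 16)" .
  have "\<bar>u\<bar> \<le> 4" using u pi_less_4 by linarith
  then have "u\<^sup>2 \<le> 4\<^sup>2" using abs_le_square_iff[of u 4] by simp
  then have "exp (- 1) \<le> exp (- u\<^sup>2 / 16)" by simp
  moreover have "1 / 4 \<le> exp (- 1 :: real)"
    using exp_le by (simp add: exp_minus field_simps)
  moreover have "- (1 / 4) \<le> (cos u + c) / 2"
    using add_mono[OF cos_ge_minus_one[of u] c(1)] by simp
  ultimately show ?thesis using upper by linarith
qed

text \<open>
  To second order the base is \<open>1 - v^2/(4 n) - t^2/(16 \<sigma>^2)\<close>, where the variance \<open>\<sigma>^2\<close> behaves like
  \<open>n / 8\<close>.
\<close>
lemma half_cos_sum_power_limit: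
  "(\<lambda>n::nat. ((cos (v / sqrt (real n)) + cos (t / (2 * sqrt (((real n)\<^sup>2 - 1) / (4 * (2 * real n - 1)))))) / 2) ^ n) \<longlonglongrightarrow> exp (- v\<^sup>2 / 4 - t\<^sup>2 / 2)"
  by (real_asymp, simp add: powr_half_sqrt field_simps power2_eq_square)

lemma sqrt_scaled_cos_kernel:
  assumes "n \<ge> 1"
  shows "sqrt n *\<^sub>R cos_kernel n s = (\<integral>v. indicator {-(pi * sqrt n)..pi * sqrt n} v *\<^sub>R
    (of_real (((cos (v / sqrt n) + cos (s / 2)) / 2) ^ n) * iexp (- (v / sqrt n))) \<partial>lborel)"
proof -
  have pos: "sqrt n > 0" using assms by simp
  have "indicator {-pi..pi} (0 + 1 / sqrt n * v) = (indicator {-(pi * sqrt n)..pi * sqrt n} v :: real)" for v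
    using pos by (auto simp: indicator_def field_simps)
  then show ?thesis
    unfolding cos_kernel_def using pos
    by (subst lborel_integral_real_affine[where c = "1 / sqrt n" and t = 0]) simp_all
qed

text \<open>
  The scaled kernel converges for every \<open>t\<close>. The factor \<open>sqrt (4 * pi)\<close> is the mass of \<open>exp (-v^2/4)\<close>
  and will cancel against the same limit at \<open>t = 0\<close>.
\<close>
lemma cos_kernel_limit:
  "(\<lambda>n. sqrt n *\<^sub>R cos_kernel n (t / sqrt (((real n)\<^sup>2 - 1) / (4 * (2 * real n - 1)))))
     \<longlonglongrightarrow> of_real (exp (- t\<^sup>2 / 2) * sqrt (4 * pi))"
proof -
  define c where "c n = cos (t / (2 * sqrt (((real n)\<^sup>2 - 1) / (4 * (2 * real n - 1)))))" for n :: nat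
  define f where "f n v = indicator {-(pi * sqrt n)..pi * sqrt n} v *\<^sub>R
    (complex_of_real (((cos (v / sqrt n) + c n) / 2) ^ n) * iexp (- (v / sqrt n)))" for n :: nat and v
  define g where "g v = complex_of_real (exp (- t\<^sup>2 / 2) * exp (- v\<^sup>2 / 4))" for v :: real
  have "c \<longlonglongrightarrow> 1" unfolding c_def by real_asymp
  then have "\<forall>\<^sub>F n in sequentially. c n > 1 / 2" by (rule order_tendstoD) simp
  then obtain N where N: "\<And>n. n \<ge> N \<Longrightarrow> c n > 1 / 2" by (auto simp: eventually_sequentially)
  have bound: "norm (f n v) \<le> exp (- v\<^sup>2 / 16)" if n: "n \<ge> Suc N" for n v
  proof (cases "v \<in> {-(pi * sqrt n)..pi * sqrt n}")
    case True
    define u where "u = v / sqrt n"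
    have pos: "sqrt n > 0" using n by simp
    have "\<bar>u\<bar> \<le> pi" using True pos by (auto simp: u_def abs_le_iff field_simps)
    then have "\<bar>(cos u + c n) / 2\<bar> \<le> exp (- u\<^sup>2 / 16)"
      using N[of n] n by (intro half_cos_sum_bound) (auto simp: c_def)
    then have "\<bar>(cos u + c n) / 2\<bar> ^ n \<le> exp (- u\<^sup>2 / 16) ^ n"
      by (rule power_mono) simp
    also have "\<dots> = exp (- v\<^sup>2 / 16)"
      using n by (simp add: exp_of_nat_mult[symmetric] u_def power_divide)
    finally show ?thesis
      using True unfolding f_def u_def[symmetric] by (simp add: norm_mult norm_power power_abs del: of_real_add)
  qed (simp add: f_def)
  have pointwise: "(\<lambda>n. f n v) \<longlonglongrightarrow> g v" for v
  proof -
    have "\<forall>\<^sub>F n in sequentially. \<bar>v\<bar> \<le> pi * sqrt (real n)" by real_asymp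
    then have ev: "\<forall>\<^sub>F n in sequentially. complex_of_real (((cos (v / sqrt n) + c n) / 2) ^ n) * iexp (- (v / sqrt n)) = f n v"
      by eventually_elim (auto simp: f_def abs_le_iff)
    have "(\<lambda>n. ((cos (v / sqrt n) + c n) / 2) ^ n) \<longlonglongrightarrow> exp (- v\<^sup>2 / 4 - t\<^sup>2 / 2)"
      unfolding c_def by (rule half_cos_sum_power_limit)
    moreover have "(\<lambda>n. iexp (- (v / sqrt n))) \<longlonglongrightarrow> iexp 0"
    proof (rule isCont_tendsto_compose[OF isCont_iexp])
      show "(\<lambda>n. - (v / sqrt (real n))) \<longlonglongrightarrow> 0" by real_asymp
    qed
    ultimately have "(\<lambda>n. complex_of_real (((cos (v / sqrt n) + c n) / 2) ^ n) * iexp (- (v / sqrt n)))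
        \<longlonglongrightarrow> of_real (exp (- v\<^sup>2 / 4 - t\<^sup>2 / 2)) * iexp 0"
      by (intro tendsto_mult tendsto_of_real)
    then have "(\<lambda>n. f n v) \<longlonglongrightarrow> of_real (exp (- v\<^sup>2 / 4 - t\<^sup>2 / 2)) * iexp 0"
      using ev by (rule Lim_transform_eventually)
    also have "of_real (exp (- v\<^sup>2 / 4 - t\<^sup>2 / 2)) * iexp 0 = g v"
      by (simp add: g_def exp_add[symmetric] exp_of_real[symmetric] del: of_real_exp)
    finally show ?thesis .
  qed
  \<comment> \<open>The domination holds only from \<open>Suc N\<close> on, hence the shift of the index.\<close>
  have "(\<lambda>n. \<integral>v. f (n + Suc N) v \<partial>lborel) \<longlonglongrightarrow> (\<integral>v. g v \<partial>lborel)"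
  proof (rule integral_dominated_convergence[where w = "\<lambda>v. exp (- v\<^sup>2 / 16)"])
    show "integrable lborel (\<lambda>v::real. exp (- v\<^sup>2 / 16))"
      using has_bochner_integral_gaussian[of 16] by (auto simp: has_bochner_integral_iff)
    show "AE v in lborel. (\<lambda>n. f (n + Suc N) v) \<longlonglongrightarrow> g v"
      using pointwise by (intro AE_I2 LIMSEQ_ignore_initial_segment) auto
    show "AE v in lborel. norm (f (n + Suc N) v) \<le> exp (- v\<^sup>2 / 16)" for n
      using bound by (intro AE_I2) simp
  qed (auto simp: f_def g_def)
  also have "(\<integral>v. g v \<partial>lborel) = of_real (exp (- t\<^sup>2 / 2) * sqrt (4 * pi))"
    using has_bochner_integral_gaussian[of 4] unfolding g_def
    by (simp add: has_bochner_integral_iff mult.commute)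
  finally have "(\<lambda>n. \<integral>v. f n v \<partial>lborel) \<longlonglongrightarrow> of_real (exp (- t\<^sup>2 / 2) * sqrt (4 * pi))"
    by (rule LIMSEQ_offset)
  moreover have "\<forall>\<^sub>F n in sequentially. (\<integral>v. f n v \<partial>lborel) =
      sqrt n *\<^sub>R cos_kernel n (t / sqrt (((real n)\<^sup>2 - 1) / (4 * (2 * real n - 1))))"
    using eventually_ge_at_top[of 1]
    by eventually_elim (simp add: sqrt_scaled_cos_kernel f_def c_def mult_ac)
  ultimately show ?thesis by (rule Lim_transform_eventually)
qed

lemma char_standardized_blocks_limit:
  "(\<lambda>n. char (distr (measure_pmf (random_nc_partition n)) borel (standardized_blocks n)) t)
     \<longlonglongrightarrow> char std_normal_distribution t"
proof -
  define \<sigma> where "\<sigma> n = sqrt (((real n)\<^sup>2 - 1) / (4 * (2 * real n - 1)))" for n :: nat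
  have "(\<lambda>n. (sqrt n *\<^sub>R cos_kernel n (t / \<sigma> n)) / (sqrt n *\<^sub>R cos_kernel n (0 / \<sigma> n)))
      \<longlonglongrightarrow> of_real (exp (- t\<^sup>2 / 2) * sqrt (4 * pi)) / of_real (exp (- 0\<^sup>2 / 2) * sqrt (4 * pi))"
    unfolding \<sigma>_def by (intro tendsto_divide cos_kernel_limit) simp
  moreover have "of_real (exp (- t\<^sup>2 / 2) * sqrt (4 * pi)) / of_real (exp (- 0\<^sup>2 / 2) * sqrt (4 * pi)) =
      char std_normal_distribution t"
    by (simp add: char_std_normal_distribution)
  moreover have "\<forall>\<^sub>F n in sequentially. (sqrt n *\<^sub>R cos_kernel n (t / \<sigma> n)) / (sqrt n *\<^sub>R cos_kernel n (0 / \<sigma> n)) =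
      char (distr (measure_pmf (random_nc_partition n)) borel (standardized_blocks n)) t"
    using eventually_ge_at_top[of 1]
    by eventually_elim (simp add: char_standardized_blocks var_blocks_eq \<sigma>_def scaleR_conv_of_real)
  ultimately show ?thesis by (simp add: Lim_transform_eventually)
qed

theorem theorem2p1:
  "(\<forall>n::nat. n \<ge> 1 \<longrightarrow>
       mean_blocks n = (real n + 1) / 2 \<and>
       var_blocks n = ((real n)\<^sup>2 - 1) / (4 * (2 * real n - 1))) \<and>
   var_blocks \<sim>[at_top] (\<lambda>n. real n / 8) \<and>
   (\<forall>x::real.
      (\<lambda>n. cdf (distr (measure_pmf (random_nc_partition n)) borel (standardized_blocks n)) x)
        \<longlonglongrightarrow> cdf std_normal_distribution x)"
proof (intro conjI allI impI)
  show "mean_blocks n = (real n + 1) / 2" if "n \<ge> 1" for n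
    using that by (rule mean_blocks_eq)
  show "var_blocks n = ((real n)\<^sup>2 - 1) / (4 * (2 * real n - 1))" if "n \<ge> 1" for n
    using that by (rule var_blocks_eq)
  have "\<forall>\<^sub>F n in at_top. var_blocks n = ((real n)\<^sup>2 - 1) / (4 * (2 * real n - 1))"
    using eventually_ge_at_top[of 1] by eventually_elim (rule var_blocks_eq)
  moreover have "(\<lambda>n::nat. ((real n)\<^sup>2 - 1) / (4 * (2 * real n - 1))) \<sim>[at_top] (\<lambda>n. real n / 8)"
    by real_asymp
  ultimately show "var_blocks \<sim>[at_top] (\<lambda>n. real n / 8)"
    by (subst asymp_equiv_cong[OF _ always_eventually]) auto
  fix x :: real
  interpret Z: real_distribution std_normal_distribution by (rule real_dist_normal_dist)
  have "weak_conv_m (\<lambda>n. distr (measure_pmf (random_nc_partition n)) borel (standardized_blocks n)) std_normal_distribution"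
    by (rule levy_continuity)
       (auto intro!: real_dist_normal_dist char_standardized_blocks_limit prob_space.real_distribution_distr measure_pmf.prob_space_axioms)
  moreover have "isCont (cdf std_normal_distribution) x"
  proof -
    \<comment> \<open>The limit has no atoms, so weak convergence is convergence at every point.\<close>
    have "emeasure std_normal_distribution {x} = (\<integral>\<^sup>+y\<in>{x}. ennreal (std_normal_density y) \<partial>lborel)"
      by (rule emeasure_density) auto
    also have "\<dots> = 0" by (simp add: nn_integral_0_iff_AE AE_lborel_singleton)
    finally show ?thesis unfolding Z.isCont_cdf by (simp add: measure_def)
  qed
  ultimately show "(\<lambda>n. cdf (distr (measure_pmf (random_nc_partition n)) borel (standardized_blocks n)) x)
      \<longlonglongrightarrow> cdf std_normal_distribution x"
    by (auto simp: weak_conv_m_def weak_conv_def)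
qed

end
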